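(* Let $X$ be a non-empty compact Hausdorff space, $\sigma:X\to X$ a homeomorphism, and $\Sigma=(X,\sigma)$. The following are equivalent: (1) The only closed ideals of $\ell^1(\Sigma)$ are $\{0\}$ and $\ell^1(\Sigma)$; (2) The only self-adjoint closed ideals of $\ell^1(\Sigma)$ are $\{0\}$ and $\ell^1(\Sigma)$; (3) $X$ has an infinite number of points, and $\Sigma$ is minimal.
   Context: Let $\alpha$ be the automorphism of $C(X)$ (continuous complex-valued functions with supremum norm $\|\cdot\|_\infty$) given by $\alpha(f)=f\circ\sigma^{-1}$. The unital Banach $^*$-algebra $\ell^1(\Sigma)$ is the Banach space $\{a:\mathbb Z\to C(X) : \|a\|=\sum_{k\in\mathbb Z}\|a(k)\|_\infty<\infty\}$ with pointwise linear operations, product $(ab)(n)=\sum_{k\in\mathbb Z}a(k)\cdot\alpha^k(b(n-k))$ and involution $a^*(n)=\overline{\alpha^n(a(-n))}$. Ideals are two-sided. An ideal $I$ is self-adjoint if $a^*\in I$ for all $a\in I$. $\Sigma$ is minimal if, for every $x\in X$, the orbit $\{\sigma^n(x):n\in\mathbb Z\}$ is dense in $X$. *)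

theory Defs
  imports "HOL-Analysis.Analysis"
begin

no_notation Infinite_Set_Sum.abs_summable_on (infix \<open>abs'_summable'_on\<close> 50)

text \<open>
  For a compact Hausdorff space \<open>X\<close>, given as a type \<open>'x\<close>, every continuous function is bounded, so
  \<open>C(X)\<close> with the supremum norm is \<open>'x \<Rightarrow>\<^sub>C complex\<close>.  The library provides the
  normed space structure on this type; completeness is there only for metrizable domains and the
  pointwise product is missing.
\<close>

instance bcontfun :: (topological_space, complete_space) complete_space
proof
  fix f :: "nat \<Rightarrow> ('a, 'b) bcontfun"
  assume "Cauchy f"
  then obtain g where "uniform_limit UNIV f g sequentially"
    using uniformly_convergent_eq_cauchy[of "\<lambda>_. True" f]
    unfolding Cauchy_def uniform_limit_sequentially_iff
    by (metis dist_fun_lt_imp_dist_val_lt)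
  from uniform_limit_bcontfunE[OF this sequentially_bot]
  obtain l' where "g = apply_bcontfun l'" "(f \<longlonglongrightarrow> l')" by metis
  then show "convergent f"
    by (intro convergentI)
qed

instance bcontfun :: (topological_space, banach) banach ..

instantiation bcontfun :: (topological_space, real_normed_algebra) real_normed_algebra
begin

definition times_bcontfun :: "('a \<Rightarrow>\<^sub>C 'b) \<Rightarrow> ('a \<Rightarrow>\<^sub>C 'b) \<Rightarrow> ('a \<Rightarrow>\<^sub>C 'b)"
  where "times_bcontfun f g = Bcontfun (\<lambda>x. f x * g x)"

lemma apply_bcontfun_times [simp]:
  fixes f g :: "'a \<Rightarrow>\<^sub>C 'b"
  shows "apply_bcontfun (f * g) x = f x * g x"
proof -
  have "norm (f x * g x) \<le> norm f * norm g" for x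
    by (rule order_trans[OF norm_mult_ineq mult_mono[OF norm_bounded norm_bounded]]) simp_all
  then have "(\<lambda>x. f x * g x) \<in> bcontfun"
    by (intro bcontfun_normI[where b = "norm f * norm g"] continuous_intros) auto
  then show ?thesis
    by (simp add: times_bcontfun_def Bcontfun_inverse)
qed

instance
proof
  fix f g h :: "'a \<Rightarrow>\<^sub>C 'b" and r :: real
  show "f * g * h = f * (g * h)" by (rule bcontfun_eqI) (simp add: mult.assoc)
  show "(f + g) * h = f * h + g * h" by (rule bcontfun_eqI) (simp add: distrib_right)
  show "f * (g + h) = f * g + f * h" by (rule bcontfun_eqI) (simp add: distrib_left)
  show "r *\<^sub>R f * g = r *\<^sub>R (f * g)" by (rule bcontfun_eqI) simp
  show "f * r *\<^sub>R g = r *\<^sub>R (f * g)" by (rule bcontfun_eqI) simp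
  show "norm (f * g) \<le> norm f * norm g"
  proof (rule norm_bound)
    show "norm (apply_bcontfun (f * g) x) \<le> norm f * norm g" for x
      unfolding apply_bcontfun_times
      by (rule order_trans[OF norm_mult_ineq mult_mono[OF norm_bounded norm_bounded]]) simp_all
  qed
qed

end

definition cnj_bcontfun :: "('x::topological_space \<Rightarrow>\<^sub>C complex) \<Rightarrow> ('x \<Rightarrow>\<^sub>C complex)"
  where "cnj_bcontfun f = Bcontfun (\<lambda>x. cnj (f x))"

lemma apply_cnj_bcontfun [simp]: "apply_bcontfun (cnj_bcontfun f) x = cnj (f x)"
proof -
  have "(\<lambda>x. cnj (f x)) \<in> bcontfun"
    by (intro bcontfun_normI[where b = "norm f"] continuous_intros) (auto simp: norm_bounded)
  then show ?thesis by (simp add: cnj_bcontfun_def Bcontfun_inverse)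
qed

lemma norm_cnj_bcontfun [simp]: "norm (cnj_bcontfun f) = norm f"
proof (rule antisym)
  show "norm (cnj_bcontfun f) \<le> norm f"
    by (rule norm_bound) (simp add: norm_bounded)
  show "norm f \<le> norm (cnj_bcontfun f)"
    by (rule norm_bound) (use norm_bounded[of "cnj_bcontfun f"] in simp)
qed


section \<open>The Banach space of summable families in \<open>C(X)\<close>\<close>

typedef (overloaded) 'x ell1 =
  "{a :: int \<Rightarrow> ('x::topological_space \<Rightarrow>\<^sub>C complex). (\<lambda>k. norm (a k)) summable_on UNIV}"
  morphisms apply_ell1 Abs_ell1
  by (rule exI[of _ "\<lambda>_. 0"]) simp

setup_lifting type_definition_ell1

lemma ell1_eqI: "(\<And>k. apply_ell1 a k = apply_ell1 b k) \<Longrightarrow> a = b"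
  by transfer auto

lemma norm_summable_ell1: "(\<lambda>k. norm (apply_ell1 a k)) summable_on UNIV"
  using apply_ell1[of a] by simp

lemma abs_summable_add:
  fixes a b :: "'i \<Rightarrow> 'b::real_normed_vector"
  assumes "a abs_summable_on S" "b abs_summable_on S"
  shows "(\<lambda>k. a k + b k) abs_summable_on S"
  using summable_on_add[OF assms]
  by (rule summable_on_comparison_test) (auto simp: norm_triangle_ineq)

instantiation ell1 :: (topological_space) real_vector
begin

lift_definition zero_ell1 :: "'a ell1" is "\<lambda>_. 0" by simp

lift_definition plus_ell1 :: "'a ell1 \<Rightarrow> 'a ell1 \<Rightarrow> 'a ell1" is "\<lambda>a b k. a k + b k"
  by (rule abs_summable_add)

lift_definition uminus_ell1 :: "'a ell1 \<Rightarrow> 'a ell1" is "\<lambda>a k. - a k" by simp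

definition minus_ell1 :: "'a ell1 \<Rightarrow> 'a ell1 \<Rightarrow> 'a ell1" where "minus_ell1 a b = a + - b"

lift_definition scaleR_ell1 :: "real \<Rightarrow> 'a ell1 \<Rightarrow> 'a ell1" is "\<lambda>r a k. r *\<^sub>R a k"
  by (simp add: summable_on_cmult_right)

instance
proof
  fix a b c :: "'a ell1" and r s :: real
  show "a + b + c = a + (b + c)" by transfer (simp add: add.assoc)
  show "a + b = b + a" by transfer (simp add: add.commute)
  show "0 + a = a" by transfer simp
  show "- a + a = 0" by transfer simp
  show "a - b = a + - b" by (rule minus_ell1_def)
  show "r *\<^sub>R (a + b) = r *\<^sub>R a + r *\<^sub>R b" by transfer (simp add: scaleR_add_right)
  show "(r + s) *\<^sub>R a = r *\<^sub>R a + s *\<^sub>R a" by transfer (simp add: scaleR_add_left)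
  show "r *\<^sub>R s *\<^sub>R a = (r * s) *\<^sub>R a" by transfer simp
  show "1 *\<^sub>R a = a" by transfer simp
qed

end

instantiation ell1 :: (topological_space) real_normed_vector
begin

definition norm_ell1 :: "'a ell1 \<Rightarrow> real" where "norm_ell1 a = (\<Sum>\<^sub>\<infinity>k. norm (apply_ell1 a k))"

definition dist_ell1 :: "'a ell1 \<Rightarrow> 'a ell1 \<Rightarrow> real" where "dist_ell1 a b = norm (a - b)"

definition sgn_ell1 :: "'a ell1 \<Rightarrow> 'a ell1" where "sgn_ell1 a = a /\<^sub>R norm a"

definition uniformity_ell1 :: "('a ell1 \<times> 'a ell1) filter"
  where "uniformity_ell1 = (INF e\<in>{0 <..}. principal {(x, y). dist x y < e})"

definition open_ell1 :: "'a ell1 set \<Rightarrow> bool"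
  where "open_ell1 S = (\<forall>x\<in>S. \<forall>\<^sub>F (x', y) in uniformity. x' = x \<longrightarrow> y \<in> S)"

instance
proof
  fix a b :: "'a ell1" and r :: real
  show "dist a b = norm (a - b)" by (rule dist_ell1_def)
  show "sgn a = a /\<^sub>R norm a" by (rule sgn_ell1_def)
  show "(uniformity :: ('a ell1 \<times> 'a ell1) filter)
      = (INF e\<in>{0 <..}. principal {(x, y). dist x y < e})" by (rule uniformity_ell1_def)
  show "open U = (\<forall>x\<in>U. \<forall>\<^sub>F (x', y) in uniformity. x' = x \<longrightarrow> y \<in> U)" for U :: "'a ell1 set"
    by (rule open_ell1_def)
  show "norm a = 0 \<longleftrightarrow> a = 0"
  proof
    assume "norm a = 0"
    then have "norm (apply_ell1 a k) = 0" for k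
      using nonneg_infsum_le_0D[of "\<lambda>k. norm (apply_ell1 a k)" UNIV k] norm_summable_ell1[of a]
      by (simp add: norm_ell1_def)
    then show "a = 0" by (intro ell1_eqI) (simp add: zero_ell1.rep_eq)
  qed (simp add: norm_ell1_def zero_ell1.rep_eq)
  show "norm (a + b) \<le> norm a + norm b"
  proof -
    have "norm (a + b) \<le> (\<Sum>\<^sub>\<infinity>k. norm (apply_ell1 a k) + norm (apply_ell1 b k))"
      unfolding norm_ell1_def
      by (rule infsum_mono)
        (auto simp: norm_summable_ell1 summable_on_add plus_ell1.rep_eq norm_triangle_ineq
          intro: abs_summable_add)
    also have "\<dots> = norm a + norm b"
      unfolding norm_ell1_def by (rule infsum_add) (rule norm_summable_ell1)+
    finally show ?thesis .
  qed
  show "norm (r *\<^sub>R a) = \<bar>r\<bar> * norm a"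
    by (simp add: norm_ell1_def scaleR_ell1.rep_eq infsum_cmult_right')
qed

end

lift_definition scaleC_ell1 :: "complex \<Rightarrow> 'x::topological_space ell1 \<Rightarrow> 'x ell1"
  is "\<lambda>c a k. const_bcontfun c * a k"
proof -
  fix c :: complex and a :: "int \<Rightarrow> ('x \<Rightarrow>\<^sub>C complex)"
  assume "(\<lambda>k. norm (a k)) summable_on UNIV"
  then have "(\<lambda>k. norm (const_bcontfun c :: 'x \<Rightarrow>\<^sub>C complex) * norm (a k)) summable_on UNIV"
    by (rule summable_on_cmult_right)
  then show "(\<lambda>k. norm (const_bcontfun c * a k)) summable_on UNIV"
    by (rule summable_on_comparison_test) (auto simp: norm_mult_ineq)
qed


section \<open>Product and involution\<close>

text \<open>Integer iterates \<open>f\<^sup>k\<close> of a bijection \<open>f\<close>.\<close>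

definition iter_int :: "('a \<Rightarrow> 'a) \<Rightarrow> int \<Rightarrow> 'a \<Rightarrow> 'a"
  where "iter_int f k = (if 0 \<le> k then f ^^ nat k else inv f ^^ nat (- k))"

text \<open>
  The definitions below apply the abstraction functions \<open>Bcontfun\<close> and \<open>Abs_ell1\<close> and are
  meaningful when \<open>\<sigma>\<close> is a homeomorphism; the lemmas with that hypothesis show that they then have
  the intended values.
\<close>

definition alpha :: "('x::topological_space \<Rightarrow> 'x) \<Rightarrow> ('x \<Rightarrow>\<^sub>C complex) \<Rightarrow> ('x \<Rightarrow>\<^sub>C complex)"
  where "alpha \<sigma> f = Bcontfun (f \<circ> inv \<sigma>)"

definition mult_ell1 ::
    "('x::topological_space \<Rightarrow> 'x) \<Rightarrow> 'x ell1 \<Rightarrow> 'x ell1 \<Rightarrow> 'x ell1"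
  where "mult_ell1 \<sigma> a b =
    Abs_ell1 (\<lambda>n. \<Sum>\<^sub>\<infinity>k. apply_ell1 a k * iter_int (alpha \<sigma>) k (apply_ell1 b (n - k)))"

definition star_ell1 :: "('x::topological_space \<Rightarrow> 'x) \<Rightarrow> 'x ell1 \<Rightarrow> 'x ell1"
  where "star_ell1 \<sigma> a =
    Abs_ell1 (\<lambda>n. cnj_bcontfun (iter_int (alpha \<sigma>) n (apply_ell1 a (- n))))"

context
  fixes \<sigma> :: "'x::topological_space \<Rightarrow> 'x"
  assumes homeo: "homeomorphism UNIV UNIV \<sigma> (inv \<sigma>)"
begin

lemma alpha_apply: "apply_bcontfun (alpha \<sigma> f) x = f (inv \<sigma> x)"
proof -
  have "continuous_on UNIV (inv \<sigma>)" using homeo by (simp add: homeomorphism_def)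
  then have "continuous_on UNIV (f \<circ> inv \<sigma>)"
    by (intro continuous_on_compose) auto
  then have "f \<circ> inv \<sigma> \<in> bcontfun"
    by (rule bcontfun_normI[where b = "norm f"]) (simp add: norm_bounded)
  then show ?thesis by (simp add: alpha_def Bcontfun_inverse)
qed

lemma norm_alpha: "norm (alpha \<sigma> f) = norm f"
proof (rule antisym)
  show "norm (alpha \<sigma> f) \<le> norm f"
    by (rule norm_bound) (simp add: alpha_apply norm_bounded)
  have "inv \<sigma> (\<sigma> x) = x" for x using homeo by (simp add: homeomorphism_def)
  then show "norm f \<le> norm (alpha \<sigma> f)"
    by (intro norm_bound) (use norm_bounded[of "alpha \<sigma> f" "\<sigma> _"] in \<open>simp add: alpha_apply\<close>)
qed

lemma bij_alpha: "bij (alpha \<sigma>)"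
proof (rule bijI)
  have s: "inv \<sigma> (\<sigma> x) = x" "\<sigma> (inv \<sigma> x) = x" for x
    using homeo by (simp_all add: homeomorphism_def)
  show "inj (alpha \<sigma>)"
    by (rule injI, rule bcontfun_eqI) (metis alpha_apply s(1))
  show "surj (alpha \<sigma>)"
  proof (rule surjI)
    fix f :: "'x \<Rightarrow>\<^sub>C complex"
    have "continuous_on UNIV \<sigma>" using homeo by (simp add: homeomorphism_def)
    then have "continuous_on UNIV (f \<circ> \<sigma>)" by (intro continuous_on_compose) auto
    then have "f \<circ> \<sigma> \<in> bcontfun"
      by (rule bcontfun_normI[where b = "norm f"]) (simp add: norm_bounded)
    then show "alpha \<sigma> (Bcontfun (f \<circ> \<sigma>)) = f"
      by (intro bcontfun_eqI) (simp add: alpha_apply Bcontfun_inverse s)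
  qed
qed

lemma norm_iter_int_alpha: "norm (iter_int (alpha \<sigma>) k f) = norm f"
proof -
  have "norm (inv (alpha \<sigma>) g) = norm g" for g
    by (metis bij_alpha bij_inv_eq_iff norm_alpha)
  then have "norm ((inv (alpha \<sigma>) ^^ m) f) = norm f" for m by (induction m) auto
  moreover have "norm ((alpha \<sigma> ^^ m) f) = norm f" for m by (induction m) (auto simp: norm_alpha)
  ultimately show ?thesis by (simp add: iter_int_def)
qed

lemma abs_summable_mult_ell1:
  "(\<lambda>(n, k). apply_ell1 a k * iter_int (alpha \<sigma>) k (apply_ell1 b (n - k)))
     abs_summable_on (UNIV \<times> UNIV)"
proof -
  let ?p = "\<lambda>(k, m). norm (apply_ell1 a k) * norm (apply_ell1 b m)"
  have "?p abs_summable_on (UNIV \<times> UNIV)"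
  proof (rule iffD2[OF Infinite_Sum.abs_summable_on_Sigma_iff], intro conjI ballI)
    show "(\<lambda>m. ?p (k, m)) abs_summable_on UNIV" for k
      by (simp add: abs_mult norm_summable_ell1 summable_on_cmult_right)
    have "(\<lambda>k. norm (apply_ell1 a k) * norm b) abs_summable_on UNIV"
      by (simp add: abs_mult norm_summable_ell1 summable_on_cmult_left)
    then show "(\<lambda>k. \<Sum>\<^sub>\<infinity>m. norm (?p (k, m))) abs_summable_on UNIV"
      by (simp add: abs_mult infsum_cmult_right' norm_ell1_def)
  qed
  then have "?p summable_on (UNIV \<times> UNIV)" by (rule abs_summable_summable)
  also have "?this \<longleftrightarrow> (\<lambda>x. ?p (case x of (n, k) \<Rightarrow> (k, n - k))) summable_on (UNIV \<times> UNIV)"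
    by (rule summable_on_reindex_bij_witness
        [where i = "\<lambda>(n, k). (k, n - k)" and j = "\<lambda>(k, m). (k + m, k)"]) auto
  finally show ?thesis
  proof (rule summable_on_comparison_test)
    fix x :: "int \<times> int"
    obtain n k where "x = (n, k)" by force
    then show "norm (case x of (n, k) \<Rightarrow>
        apply_ell1 a k * iter_int (alpha \<sigma>) k (apply_ell1 b (n - k)))
        \<le> ?p (case x of (n, k) \<Rightarrow> (k, n - k))"
      using norm_mult_ineq[of "apply_ell1 a k" "iter_int (alpha \<sigma>) k (apply_ell1 b (n - k))"]
      by (simp add: norm_iter_int_alpha)
  qed auto
qed

lemma mult_ell1_has_sum:
  "((\<lambda>k. apply_ell1 a k * iter_int (alpha \<sigma>) k (apply_ell1 b (n - k)))
     has_sum apply_ell1 (mult_ell1 \<sigma> a b) n) UNIV"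
proof -
  let ?t = "\<lambda>n k. apply_ell1 a k * iter_int (alpha \<sigma>) k (apply_ell1 b (n - k))"
  note * = iffD1[OF Infinite_Sum.abs_summable_on_Sigma_iff, OF abs_summable_mult_ell1[of a b]]
  have inner: "?t n abs_summable_on UNIV" for n
    using bspec[OF conjunct1[OF *], of n] by (simp only: prod.case UNIV_I)
  have outer: "(\<lambda>n. \<Sum>\<^sub>\<infinity>k. norm (?t n k)) abs_summable_on UNIV"
    using conjunct2[OF *] by (simp only: prod.case)
  have "(\<lambda>n. \<Sum>\<^sub>\<infinity>k. ?t n k) abs_summable_on UNIV"
    by (rule Infinite_Sum.abs_summable_on_comparison_test[OF outer])
      (use norm_infsum_bound[OF inner] in \<open>auto simp: infsum_nonneg\<close>)
  then have "apply_ell1 (mult_ell1 \<sigma> a b) n = (\<Sum>\<^sub>\<infinity>k. ?t n k)"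
    by (simp add: mult_ell1_def Abs_ell1_inverse)
  then show ?thesis
    using abs_summable_summable[OF inner] by simp
qed

lemma apply_star_ell1:
  "apply_ell1 (star_ell1 \<sigma> a) n = cnj_bcontfun (iter_int (alpha \<sigma>) n (apply_ell1 a (- n)))"
proof -
  have "(\<lambda>n. norm (apply_ell1 a (- n))) summable_on UNIV
      \<longleftrightarrow> (\<lambda>n. norm (apply_ell1 a n)) summable_on UNIV"
    by (rule summable_on_reindex_bij_witness[where i = uminus and j = uminus]) auto
  then show ?thesis
    by (simp add: star_ell1_def Abs_ell1_inverse norm_iter_int_alpha norm_summable_ell1)
qed

end


section \<open>Ideals and minimality\<close>

definition ideal_ell1 :: "('x::topological_space \<Rightarrow> 'x) \<Rightarrow> 'x ell1 set \<Rightarrow> bool"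
  where "ideal_ell1 \<sigma> I \<longleftrightarrow>
    0 \<in> I \<and> (\<forall>a\<in>I. \<forall>b\<in>I. a + b \<in> I) \<and> (\<forall>c. \<forall>a\<in>I. scaleC_ell1 c a \<in> I) \<and>
    (\<forall>a\<in>I. \<forall>b. mult_ell1 \<sigma> a b \<in> I \<and> mult_ell1 \<sigma> b a \<in> I)"

definition self_adjoint_ell1 :: "('x::topological_space \<Rightarrow> 'x) \<Rightarrow> 'x ell1 set \<Rightarrow> bool"
  where "self_adjoint_ell1 \<sigma> I \<longleftrightarrow> (\<forall>a\<in>I. star_ell1 \<sigma> a \<in> I)"

definition minimal_system :: "('x::topological_space \<Rightarrow> 'x) \<Rightarrow> bool"
  where "minimal_system \<sigma> \<longleftrightarrow> (\<forall>x. closure (range (\<lambda>n::int. iter_int \<sigma> n x)) = UNIV)"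

end

theory Submission
  imports Defs
begin

text \<open>
  Write \<open>u\<close> for the canonical unitary, so that the elements of \<open>\<ell>\<^sup>1(\<Sigma>)\<close> are the series
  \<open>\<Sum>n. a(n) u\<^sup>n\<close>.

  Suppose that there are no nontrivial self-adjoint closed ideals.  A nondense orbit has as closure
  a proper closed invariant set, and the elements whose coefficients vanish on it form such an
  ideal (\<open>no_self_adjoint_ideals_imp_minimal\<close>).  If \<open>X\<close> is finite, some power \<open>\<sigma>\<^sup>p\<close> with \<open>p > 0\<close> is
  the identity, so \<open>u\<^sup>p - 1\<close> acts as zero in the natural representation on the functions on \<open>X\<close>,
  whose kernel is again such an ideal (\<open>no_self_adjoint_ideals_imp_infinite\<close>).

  Conversely, an infinite minimal system is free: no \<open>\<sigma>\<^sup>n\<close> with \<open>n \<noteq> 0\<close> has a fixed point.  Freeness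
  makes it possible to remove the off-diagonal coefficients of an element \<open>a\<close> of a closed ideal
  \<open>I\<close>.  A function \<open>f\<close> supported in a set \<open>U\<close> satisfies \<open>f (a(n) u\<^sup>n) f = 0\<close> if \<open>U\<close> and \<open>\<sigma>\<^sup>n(U)\<close>
  are disjoint, and summing over a partition \<open>\<Sum>s. f\<^sub>s\<^sup>2 = 1\<close> into such functions keeps \<open>a(0)\<close>
  unchanged, removes any prescribed finite set of other coefficients and does not enlarge the
  remaining ones.  Hence \<open>a(0)\<close> is a limit of elements
  of \<open>I\<close> and lies in \<open>I\<close> (\<open>zeroth_coefficient_in_closed_ideal\<close>).  If \<open>I \<noteq> 0\<close>, some coefficient of
  some element is nonzero and can be moved to position 0, so \<open>I\<close> contains a nonzero function; by
  minimality and compactness finitely many translates of its squared modulus add up to an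
  invertible function in \<open>I\<close> (\<open>ideal_containing_function_eq_UNIV\<close>).
\<close>


section \<open>Iterates of a bijection and orbits\<close>

lemma iter_int_0 [simp]: "iter_int f 0 x = x"
  by (simp add: iter_int_def)

lemma iter_int_1: "iter_int f 1 x = f x"
  by (simp add: iter_int_def)

lemma iter_int_minus_1: "iter_int f (- 1) x = inv f x"
  by (simp add: iter_int_def)

lemma iter_int_Suc:
  assumes "bij f"
  shows "iter_int f (k + 1) x = f (iter_int f k x)"
proof (cases "0 \<le> k")
  case True
  then show ?thesis by (simp add: iter_int_def nat_add_distrib)
next
  case False
  then have "nat (- k) = Suc (nat (- (k + 1)))" by simp
  moreover have "f (inv f y) = y" for y
    using assms by (simp add: bij_is_surj surj_f_inv_f)
  ultimately show ?thesis using False by (auto simp: iter_int_def)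
qed

lemma iter_int_add:
  assumes "bij f"
  shows "iter_int f (m + n) x = iter_int f m (iter_int f n x)"
proof (induction m rule: int_induct[where k = 0])
  case (step1 m)
  then show ?case
    using iter_int_Suc[OF assms, of "m + n" x] iter_int_Suc[OF assms, of m]
    by (simp add: algebra_simps)
next
  case (step2 m)
  have "f (iter_int f (m - 1 + n) x) = f (iter_int f (m - 1) (iter_int f n x))"
    using step2 iter_int_Suc[OF assms, of "m - 1 + n" x] iter_int_Suc[OF assms, of "m - 1"]
    by (simp add: algebra_simps)
  then show ?case using assms by (simp add: bij_is_inj inj_eq)
qed simp

lemma iter_int_cancel:
  assumes "bij f"
  shows "iter_int f (- k) (iter_int f k x) = x" "iter_int f k (iter_int f (- k) x) = x"
  by (simp_all flip: iter_int_add[OF assms])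

lemma iter_int_eq_iff:
  assumes "bij f"
  shows "iter_int f k x = y \<longleftrightarrow> x = iter_int f (- k) y"
  by (auto simp: iter_int_cancel[OF assms])

text \<open>A point with a nontrivial period visits only as many points as the period is long.\<close>

lemma finite_orbit_of_periodic_point:
  assumes "bij f" "p \<noteq> 0" "iter_int f p x = x"
  shows "finite (range (\<lambda>n. iter_int f n x))"
proof -
  have mult: "iter_int f (p * q) x = x" for q
  proof (induction q rule: int_induct[where k = 0])
    case (step1 q)
    then show ?case using iter_int_add[OF assms(1), of "p * q" p x] assms(3)
      by (simp add: algebra_simps)
  next
    case (step2 q)
    then show ?case using iter_int_add[OF assms(1), of "p * (q - 1)" p x] assms(3)
      by (simp add: algebra_simps)
  qed simp
  have "iter_int f n x \<in> (\<lambda>n. iter_int f n x) ` {- \<bar>p\<bar>..\<bar>p\<bar>}" for n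
  proof -
    have "iter_int f n x = iter_int f (n mod p) x"
      using iter_int_add[OF assms(1), of "n mod p" "p * (n div p)" x] mult by simp
    moreover have "\<bar>n mod p\<bar> \<le> \<bar>p\<bar>"
      using abs_mod_less[OF assms(2), of n] by simp
    then have "n mod p \<in> {- \<bar>p\<bar>..\<bar>p\<bar>}" by (auto simp: abs_le_iff)
    ultimately show ?thesis by blast
  qed
  then have "range (\<lambda>n. iter_int f n x) \<subseteq> (\<lambda>n. iter_int f n x) ` {- \<bar>p\<bar>..\<bar>p\<bar>}" by blast
  then show ?thesis by (rule finite_subset) simp
qed

text \<open>On a finite set two powers of a bijection coincide, so some nontrivial power is the identity.\<close>

lemma finite_imp_uniform_period:
  assumes "finite (UNIV :: 'a set)" "bij (f :: 'a \<Rightarrow> 'a)"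
  obtains p where "p > 0" "\<And>x. iter_int f p x = x"
proof -
  have "finite (UNIV :: ('a \<Rightarrow> 'a) set)"
    using finite_set_of_finite_funs[OF assms(1) assms(1)] by simp
  then have "finite (range (iter_int f))"
    by (rule finite_subset[rotated]) simp
  then have "\<not> inj_on (iter_int f) {0..}"
    using infinite_Ici[of "0::int"] by (metis finite_imageD finite_subset image_mono top_greatest)
  then obtain m n where "m \<noteq> n" "iter_int f m = iter_int f n"
    unfolding inj_on_def by blast
  moreover have "iter_int f (n - m) x = x" if "iter_int f m = iter_int f n" for m n x
  proof -
    have "iter_int f (n - m) x = iter_int f (- m) (iter_int f n x)"
      by (simp flip: iter_int_add[OF assms(2)])
    then show ?thesis using that iter_int_cancel(1)[OF assms(2), of m x] by simp
  qed
  ultimately show ?thesis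
    using that[of "n - m"] that[of "m - n"] by (cases "m < n") (simp_all add: not_less)
qed

context
  fixes \<sigma> :: "'x::topological_space \<Rightarrow> 'x"
  assumes homeo: "homeomorphism UNIV UNIV \<sigma> (inv \<sigma>)"
begin

lemma bij_of_homeomorphism: "bij \<sigma>"
  using homeo by (intro o_bij[of "inv \<sigma>"]) (auto simp: homeomorphism_def fun_eq_iff)

lemma continuous_iter_int: "continuous_on UNIV (iter_int \<sigma> k)"
proof -
  have "continuous_on UNIV (g ^^ n)" if "continuous_on UNIV g" for g :: "'x \<Rightarrow> 'x" and n
    using that
  proof (induction n)
    case (Suc n)
    then have "continuous_on UNIV (g \<circ> (g ^^ n))"
      by (intro continuous_on_compose) (auto intro: continuous_on_subset)
    then show ?case by simp
  qed (simp add: id_def)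
  then show ?thesis using homeo by (simp add: iter_int_def homeomorphism_def)
qed

lemma open_vimage_iter_int: "open U \<Longrightarrow> open (iter_int \<sigma> k -` U)"
  using continuous_iter_int by (rule open_vimage[rotated])

lemma iter_int_alpha_apply: "apply_bcontfun (iter_int (alpha \<sigma>) k f) x = f (iter_int \<sigma> (- k) x)"
proof (induction k arbitrary: x rule: int_induct[where k = 0])
  case (step1 k)
  have "iter_int \<sigma> (- k) (inv \<sigma> x) = iter_int \<sigma> (- (k + 1)) x"
    using iter_int_add[OF bij_of_homeomorphism, of "- k" "- 1" x]
    by (simp add: iter_int_minus_1)
  then show ?case
    using step1 by (simp add: iter_int_Suc[OF bij_alpha[OF homeo]] alpha_apply[OF homeo])
next
  case (step2 k)
  have "iter_int (alpha \<sigma>) k f = alpha \<sigma> (iter_int (alpha \<sigma>) (k - 1) f)"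
    using iter_int_Suc[OF bij_alpha[OF homeo], of "k - 1" f] by simp
  then have "apply_bcontfun (iter_int (alpha \<sigma>) (k - 1) f) x = iter_int (alpha \<sigma>) k f (\<sigma> x)"
    using bij_is_inj[OF bij_of_homeomorphism] by (simp add: alpha_apply[OF homeo])
  then show ?case
    using step2 iter_int_add[OF bij_of_homeomorphism, of "- k" 1 x] by (simp add: iter_int_1)
qed simp

end

text \<open>A finite orbit is closed, so by density it would be all of the infinite space.\<close>

lemma infinite_minimal_imp_free:
  fixes \<sigma> :: "'x::t2_space \<Rightarrow> 'x"
  assumes "bij \<sigma>" "infinite (UNIV :: 'x set)" "minimal_system \<sigma>" "n \<noteq> 0"
  shows "iter_int \<sigma> n x \<noteq> x"
proof
  assume "iter_int \<sigma> n x = x"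
  then have fin: "finite (range (\<lambda>k. iter_int \<sigma> k x))"
    using finite_orbit_of_periodic_point assms by metis
  then have "closure (range (\<lambda>k. iter_int \<sigma> k x)) = range (\<lambda>k. iter_int \<sigma> k x)"
    by (simp add: finite_imp_closed)
  then show False using fin assms(2,3) unfolding minimal_system_def by metis
qed


section \<open>Coefficients and monomials\<close>

lemma apply_ell1_add: "apply_ell1 (a + b) k = apply_ell1 a k + apply_ell1 b k"
  by (simp add: plus_ell1.rep_eq)

lemma apply_ell1_diff: "apply_ell1 (a - b) k = apply_ell1 a k - apply_ell1 b k"
  unfolding minus_ell1_def plus_ell1.rep_eq uminus_ell1.rep_eq by simp

lemma apply_ell1_sum: "apply_ell1 (\<Sum>s\<in>S. a s) k = (\<Sum>s\<in>S. apply_ell1 (a s) k)"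
  by (induction S rule: infinite_finite_induct) (simp_all add: zero_ell1.rep_eq apply_ell1_add)

lemma apply_bcontfun_sum: "apply_bcontfun (\<Sum>s\<in>S. f s) x = (\<Sum>s\<in>S. f s x)"
  by (induction S rule: infinite_finite_induct) simp_all

lemma norm_apply_ell1_le: "norm (apply_ell1 a k) \<le> norm a"
proof -
  have "(\<Sum>j\<in>{k}. norm (apply_ell1 a j)) \<le> (\<Sum>\<^sub>\<infinity>j. norm (apply_ell1 a j))"
    by (rule finite_sum_le_infsum[OF norm_summable_ell1]) auto
  then show ?thesis by (simp add: norm_ell1_def)
qed

lemma bounded_linear_apply_bcontfun:
  "bounded_linear (\<lambda>f :: 'a::topological_space \<Rightarrow>\<^sub>C 'b::real_normed_vector. apply_bcontfun f x)"
proof (rule bounded_linear_intro[where K = 1])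
  show "norm (apply_bcontfun f x) \<le> norm f * 1" for f :: "'a \<Rightarrow>\<^sub>C 'b"
    by (simp add: norm_bounded)
qed simp_all

lemma bounded_linear_apply_ell1:
  "bounded_linear (\<lambda>a :: 'x::topological_space ell1. apply_ell1 a k)"
proof (rule bounded_linear_intro[where K = 1])
  show "apply_ell1 (a + b) k = apply_ell1 a k + apply_ell1 b k" for a b :: "'x ell1"
    by (rule apply_ell1_add)
  show "apply_ell1 (r *\<^sub>R a) k = r *\<^sub>R apply_ell1 a k" for r and a :: "'x ell1"
    by (simp add: scaleR_ell1.rep_eq)
  show "norm (apply_ell1 a k) \<le> norm a * 1" for a :: "'x ell1"
    by (simp add: norm_apply_ell1_le)
qed

text \<open>
  The monomial \<open>f u\<^sup>k\<close>, where \<open>u\<close> is the canonical unitary with \<open>u f u\<^sup>-\<^sup>1 = \<alpha>(f)\<close>.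
\<close>

lift_definition single_ell1 :: "int \<Rightarrow> ('x::topological_space \<Rightarrow>\<^sub>C complex) \<Rightarrow> 'x ell1"
  is "\<lambda>k f n. if n = k then f else 0"
proof -
  fix k :: int and f :: "'x \<Rightarrow>\<^sub>C complex"
  show "(\<lambda>n. norm (if n = k then f else 0)) summable_on UNIV"
    by (rule has_sum_imp_summable[OF has_sum_finite_neutralI[of "{k}", OF _ _ _ refl]]) auto
qed

lemma apply_single_ell1: "apply_ell1 (single_ell1 k f) n = (if n = k then f else 0)"
  by (simp add: single_ell1.rep_eq)

context
  fixes \<sigma> :: "'x::topological_space \<Rightarrow> 'x"
  assumes homeo: "homeomorphism UNIV UNIV \<sigma> (inv \<sigma>)"
begin

lemma mult_ell1_apply_has_sum:
  "((\<lambda>k. apply_ell1 a k x * apply_ell1 b (n - k) (iter_int \<sigma> (- k) x))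
     has_sum apply_ell1 (mult_ell1 \<sigma> a b) n x) UNIV"
  using has_sum_bounded_linear[OF bounded_linear_apply_bcontfun[of x]
      mult_ell1_has_sum[OF homeo, of a b n]]
  by (simp add: iter_int_alpha_apply[OF homeo])

lemma mult_single_left_apply:
  "apply_ell1 (mult_ell1 \<sigma> (single_ell1 j f) b) n x = f x * apply_ell1 b (n - j) (iter_int \<sigma> (- j) x)"
  by (rule has_sum_unique[OF mult_ell1_apply_has_sum has_sum_finite_neutralI[of "{j}"]])
    (auto simp: apply_single_ell1)

lemma mult_single_right_apply:
  "apply_ell1 (mult_ell1 \<sigma> a (single_ell1 j f)) n x = apply_ell1 a (n - j) x * f (iter_int \<sigma> (j - n) x)"
  by (rule has_sum_unique[OF mult_ell1_apply_has_sum has_sum_finite_neutralI[of "{n - j}"]])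
    (auto simp: apply_single_ell1)

end

lemma ideal_ell1_sum:
  assumes "ideal_ell1 \<sigma> I" "\<And>s. s \<in> S \<Longrightarrow> a s \<in> I"
  shows "(\<Sum>s\<in>S. a s) \<in> I"
  using assms(2)
  by (induction S rule: infinite_finite_induct) (use assms(1) in \<open>simp_all add: ideal_ell1_def\<close>)


section \<open>Minimality is necessary\<close>

text \<open>
  For a closed invariant set \<open>Y\<close> this is the kernel of the homomorphism from \<open>\<ell>\<^sup>1(\<Sigma>)\<close> to the
  algebra of the subsystem on \<open>Y\<close> that restricts every coefficient to \<open>Y\<close>.
\<close>

definition vanishing_ideal :: "'x::topological_space set \<Rightarrow> 'x ell1 set"
  where "vanishing_ideal Y = {a. \<forall>k. \<forall>y\<in>Y. apply_ell1 a k y = 0}"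

lemma closed_vanishing_ideal: "closed (vanishing_ideal (Y :: 'a::topological_space set))"
proof -
  have "closed {a. apply_ell1 a k y = 0}" for k and y :: 'a
    using bounded_linear_compose[OF bounded_linear_apply_bcontfun[of y] bounded_linear_apply_ell1[of k]]
    by (intro closed_Collect_eq linear_continuous_on continuous_on_const)
  moreover have "vanishing_ideal Y = (\<Inter>k. \<Inter>y\<in>Y. {a. apply_ell1 a k y = 0})"
    by (auto simp: vanishing_ideal_def)
  ultimately show ?thesis
    by (simp only:) (intro closed_INT ballI; assumption)
qed

lemma ideal_vanishing_ideal:
  fixes \<sigma> :: "'x::topological_space \<Rightarrow> 'x"
  assumes homeo: "homeomorphism UNIV UNIV \<sigma> (inv \<sigma>)"
    and inv: "\<And>k y. y \<in> Y \<Longrightarrow> iter_int \<sigma> k y \<in> Y"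
  shows "ideal_ell1 \<sigma> (vanishing_ideal Y)"
proof -
  have "apply_ell1 (mult_ell1 \<sigma> a b) n y = 0"
    if "y \<in> Y" "a \<in> vanishing_ideal Y \<or> b \<in> vanishing_ideal Y" for a b n y
    by (rule has_sum_unique[OF mult_ell1_apply_has_sum[OF homeo]])
      (use that inv in \<open>auto intro!: has_sum_0 simp: vanishing_ideal_def\<close>)
  then show ?thesis
    by (auto simp: ideal_ell1_def vanishing_ideal_def zero_ell1.rep_eq apply_ell1_add
        scaleC_ell1.rep_eq)
qed

lemma self_adjoint_vanishing_ideal:
  fixes \<sigma> :: "'x::topological_space \<Rightarrow> 'x"
  assumes homeo: "homeomorphism UNIV UNIV \<sigma> (inv \<sigma>)"
    and inv: "\<And>k y. y \<in> Y \<Longrightarrow> iter_int \<sigma> k y \<in> Y"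
  shows "self_adjoint_ell1 \<sigma> (vanishing_ideal Y)"
  using inv by (auto simp: self_adjoint_ell1_def vanishing_ideal_def apply_star_ell1[OF homeo]
      iter_int_alpha_apply[OF homeo])

lemma closure_orbit_invariant:
  fixes \<sigma> :: "'x::topological_space \<Rightarrow> 'x"
  assumes homeo: "homeomorphism UNIV UNIV \<sigma> (inv \<sigma>)"
    and y: "y \<in> closure (range (\<lambda>n. iter_int \<sigma> n x))"
  shows "iter_int \<sigma> k y \<in> closure (range (\<lambda>n. iter_int \<sigma> n x))"
proof -
  have "iter_int \<sigma> k ` closure (range (\<lambda>n. iter_int \<sigma> n x)) \<subseteq> closure (range (\<lambda>n. iter_int \<sigma> n x))"
  proof (rule image_closure_subset)
    show "iter_int \<sigma> k ` range (\<lambda>n. iter_int \<sigma> n x) \<subseteq> closure (range (\<lambda>n. iter_int \<sigma> n x))"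
      using closure_subset[of "range (\<lambda>n. iter_int \<sigma> n x)"]
      by (force simp flip: iter_int_add[OF bij_of_homeomorphism[OF homeo]])
  qed (auto intro: continuous_on_subset[OF continuous_iter_int[OF homeo]])
  then show ?thesis using y by blast
qed

lemma continuous_imp_bcontfun:
  fixes g :: "'x::topological_space \<Rightarrow> 'b::real_normed_vector"
  assumes "compact (UNIV :: 'x set)" "continuous_on UNIV g"
  shows "g \<in> bcontfun"
  using assms compact_imp_bounded[OF compact_continuous_image[OF assms(2,1)]]
  by (simp add: bcontfun_def)

lemma apply_Bcontfun_of_real:
  fixes f :: "'x::topological_space \<Rightarrow> real"
  assumes "compact (UNIV :: 'x set)" "continuous_on UNIV f"
  shows "apply_bcontfun (Bcontfun (\<lambda>x. complex_of_real (f x))) y = f y"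
proof -
  have "(\<lambda>x. complex_of_real (f x)) \<in> bcontfun"
    by (intro continuous_imp_bcontfun continuous_on_of_real assms)
  then show ?thesis by (simp add: Bcontfun_inverse)
qed

lemma bump_function:
  fixes z :: "'x::t2_space"
  assumes "compact (UNIV :: 'x set)" "open U" "z \<in> U"
  obtains f :: "'x \<Rightarrow> real" where "continuous_on UNIV f" "f z = 1" "\<And>y. f y \<noteq> 0 \<Longrightarrow> y \<in> U"
proof -
  have "compact_space (euclidean :: 'x topology)"
    using assms(1) by (simp add: compact_space_def)
  moreover have "Hausdorff_space (euclidean :: 'x topology)"
    unfolding Hausdorff_space_def disjnt_def using hausdorff by (metis open_openin)
  ultimately have "normal_space (euclidean :: 'x topology)"
    by (simp add: compact_Hausdorff_or_regular_imp_normal_space)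
  moreover have "closedin euclidean (- U)" "closedin euclidean {z}" "disjnt (- U) {z}"
    using assms by (simp_all add: disjnt_def closed_Compl)
  ultimately obtain f :: "'x \<Rightarrow> real"
    where "continuous_map euclidean euclideanreal f" "f ` (- U) \<subseteq> {0}" "f ` {z} \<subseteq> {1}"
    by (rule Urysohn_lemma_alt)
  then show ?thesis by (intro that[of f]) auto
qed

text \<open>
  The closure \<open>Y\<close> of the orbit of \<open>x\<close> is invariant.  The unit does not vanish at \<open>x\<close>, so the vanishing
  ideal of \<open>Y\<close> is proper and hence zero; but a point outside \<open>Y\<close> would carry a bump function that
  vanishes on \<open>Y\<close>.
\<close>

lemma no_self_adjoint_ideals_imp_minimal:
  fixes \<sigma> :: "'x::t2_space \<Rightarrow> 'x"
  assumes comp: "compact (UNIV :: 'x set)"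
    and homeo: "homeomorphism UNIV UNIV \<sigma> (inv \<sigma>)"
    and simple: "\<And>I. ideal_ell1 \<sigma> I \<Longrightarrow> self_adjoint_ell1 \<sigma> I \<Longrightarrow> closed I \<Longrightarrow> I = {0} \<or> I = UNIV"
  shows "minimal_system \<sigma>"
  unfolding minimal_system_def
proof
  fix x
  define Y where "Y = closure (range (\<lambda>n. iter_int \<sigma> n x))"
  have inv: "iter_int \<sigma> k y \<in> Y" if "y \<in> Y" for k y
    using closure_orbit_invariant[OF homeo] that by (simp add: Y_def)
  have "x \<in> Y"
    unfolding Y_def by (rule subsetD[OF closure_subset]) (metis iter_int_0 rangeI)
  then have "single_ell1 0 (const_bcontfun 1) \<notin> vanishing_ideal Y"
    by (auto simp: vanishing_ideal_def apply_single_ell1)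
  then have zero: "vanishing_ideal Y = {0}"
    using simple[OF ideal_vanishing_ideal[OF homeo inv] self_adjoint_vanishing_ideal[OF homeo inv]
        closed_vanishing_ideal] by blast
  have "z \<in> Y" for z
  proof (rule ccontr)
    assume "z \<notin> Y"
    moreover have "open (- Y)" by (simp add: Y_def open_Compl)
    ultimately obtain f :: "'x \<Rightarrow> real"
      where f: "continuous_on UNIV f" "f z = 1" "\<And>y. f y \<noteq> 0 \<Longrightarrow> y \<in> - Y"
      using bump_function[OF comp, of "- Y" z] by auto
    define g where "g = Bcontfun (\<lambda>y. complex_of_real (f y))"
    have g: "apply_bcontfun g y = f y" for y
      unfolding g_def by (rule apply_Bcontfun_of_real[OF comp f(1)])
    have "f y = 0" if "y \<in> Y" for y using f(3)[of y] that by blast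
    then have "single_ell1 0 g \<in> vanishing_ideal Y"
      by (auto simp: vanishing_ideal_def apply_single_ell1 g)
    then have "apply_ell1 (single_ell1 0 g) 0 z = 0"
      by (simp add: zero zero_ell1.rep_eq)
    then show False using f(2) by (simp add: apply_single_ell1 g)
  qed
  then show "closure (range (\<lambda>n. iter_int \<sigma> n x)) = UNIV" by (auto simp: Y_def)
qed


section \<open>Infinitely many points are necessary\<close>

lemma bounded_rangeE:
  assumes "bounded (range \<xi>)"
  obtains B where "\<And>y. norm (\<xi> y) \<le> B"
proof -
  obtain B where "\<forall>z\<in>range \<xi>. norm z \<le> B" using assms unfolding bounded_iff by blast
  then show ?thesis using that[of B] by simp
qed

lemma has_sum_finite_sum:
  fixes f :: "'a \<Rightarrow> 'i \<Rightarrow> 'b::topological_comm_monoid_add"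
  assumes "finite A" "\<And>a. a \<in> A \<Longrightarrow> (f a has_sum s a) B"
  shows "((\<lambda>i. \<Sum>a\<in>A. f a i) has_sum (\<Sum>a\<in>A. s a)) B"
  using assms by (induction A rule: finite_induct) (simp_all add: has_sum_add)

text \<open>
  The operator by which \<open>a\<close> acts on functions on \<open>X\<close> when \<open>C(X)\<close> acts by multiplication and the
  unitary implementing \<open>\<alpha>\<close> acts by composition with \<open>\<sigma>\<^sup>-\<^sup>1\<close>.
\<close>

definition covariant_rep ::
    "('x::topological_space \<Rightarrow> 'x) \<Rightarrow> 'x ell1 \<Rightarrow> ('x \<Rightarrow> complex) \<Rightarrow> 'x \<Rightarrow> complex"
  where "covariant_rep \<sigma> a \<xi> x = (\<Sum>\<^sub>\<infinity>n. apply_ell1 a n x * \<xi> (iter_int \<sigma> (- n) x))"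

text \<open>Bounded \<open>\<xi>\<close> are used because the series above converges absolutely for them.\<close>

definition rep_kernel :: "('x::topological_space \<Rightarrow> 'x) \<Rightarrow> 'x ell1 set"
  where "rep_kernel \<sigma> = {a. \<forall>\<xi>. bounded (range \<xi>) \<longrightarrow> (\<forall>x. covariant_rep \<sigma> a \<xi> x = 0)}"

lemma covariant_rep_has_sum:
  assumes "\<And>y. norm (\<xi> y) \<le> B"
  shows "((\<lambda>n. apply_ell1 a n x * \<xi> (iter_int \<sigma> (- n) x)) has_sum covariant_rep \<sigma> a \<xi> x) UNIV"
    and "norm (covariant_rep \<sigma> a \<xi> x) \<le> norm a * B"
proof -
  have le: "norm (apply_ell1 a n x * \<xi> (iter_int \<sigma> (- n) x)) \<le> norm (apply_ell1 a n) * B" for n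
    unfolding norm_mult by (rule mult_mono[OF norm_bounded assms]) simp_all
  have sum: "((\<lambda>n. norm (apply_ell1 a n) * B) has_sum norm a * B) UNIV"
    unfolding norm_ell1_def by (intro has_sum_cmult_left has_sum_infsum norm_summable_ell1)
  have "(\<lambda>n. norm (apply_ell1 a n x * \<xi> (iter_int \<sigma> (- n) x))) summable_on UNIV"
    by (rule summable_on_comparison_test[OF has_sum_imp_summable[OF sum]]) (simp_all add: le)
  then have "(\<lambda>n. apply_ell1 a n x * \<xi> (iter_int \<sigma> (- n) x)) summable_on UNIV"
    by (rule abs_summable_summable)
  then show has: "((\<lambda>n. apply_ell1 a n x * \<xi> (iter_int \<sigma> (- n) x)) has_sum covariant_rep \<sigma> a \<xi> x) UNIV"
    unfolding covariant_rep_def by (rule has_sum_infsum)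
  show "norm (covariant_rep \<sigma> a \<xi> x) \<le> norm a * B"
    by (rule norm_infsum_le[OF has sum]) (rule le)
qed

lemma bounded_linear_covariant_rep:
  assumes "\<And>y. norm (\<xi> y) \<le> B"
  shows "bounded_linear (\<lambda>a. covariant_rep \<sigma> a \<xi> x)"
proof (rule bounded_linear_intro[where K = B])
  note sums = covariant_rep_has_sum(1)[where \<xi> = \<xi>, OF assms]
  show "covariant_rep \<sigma> (a + b) \<xi> x = covariant_rep \<sigma> a \<xi> x + covariant_rep \<sigma> b \<xi> x" for a b
    by (rule has_sum_unique[OF sums])
      (use has_sum_add[OF sums[where a = a] sums[where a = b]] in \<open>simp add: apply_ell1_add distrib_right\<close>)
  show "covariant_rep \<sigma> (r *\<^sub>R a) \<xi> x = r *\<^sub>R covariant_rep \<sigma> a \<xi> x" for r a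
    by (rule has_sum_unique[OF sums])
      (use has_sum_cmult_right[OF sums[where a = a], of "of_real r"]
        in \<open>simp add: scaleR_ell1.rep_eq scaleR_conv_of_real mult.assoc\<close>)
  show "norm (covariant_rep \<sigma> a \<xi> x) \<le> norm a * B" for a
    by (rule covariant_rep_has_sum(2)[where \<xi> = \<xi>, OF assms])
qed

lemma covariant_rep_single:
  "covariant_rep \<sigma> (single_ell1 k f) \<xi> x = f x * \<xi> (iter_int \<sigma> (- k) x)"
  unfolding covariant_rep_def
  by (rule infsumI, rule has_sum_finite_neutralI[of "{k}"]) (auto simp: apply_single_ell1)

text \<open>Multiplicativity is an exchange of the two absolutely convergent summations.\<close>

lemma covariant_rep_mult:
  fixes \<sigma> :: "'x::topological_space \<Rightarrow> 'x"
  assumes homeo: "homeomorphism UNIV UNIV \<sigma> (inv \<sigma>)"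
    and \<xi>: "\<And>y. norm (\<xi> y) \<le> B"
  shows "covariant_rep \<sigma> (mult_ell1 \<sigma> a b) \<xi> x = covariant_rep \<sigma> a (covariant_rep \<sigma> b \<xi>) x"
proof -
  let ?u = "\<lambda>n k. apply_ell1 a k * iter_int (alpha \<sigma>) k (apply_ell1 b (n - k))"
  let ?t = "\<lambda>n k. ?u n k x * \<xi> (iter_int \<sigma> (- n) x)"
  have "(\<lambda>p. norm (case p of (n, k) \<Rightarrow> ?u n k) * B) summable_on (UNIV \<times> UNIV)"
    by (rule summable_on_cmult_left[OF abs_summable_mult_ell1[OF homeo]])
  then have "(\<lambda>p. norm (case p of (n, k) \<Rightarrow> ?t n k)) summable_on (UNIV \<times> UNIV)"
  proof (rule summable_on_comparison_test)
    fix p :: "int \<times> int"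
    obtain n k where "p = (n, k)" by force
    moreover have "norm (?t n k) \<le> norm (?u n k) * B"
      unfolding norm_mult by (rule mult_mono[OF norm_bounded \<xi>]) simp_all
    ultimately show "norm (case p of (n, k) \<Rightarrow> ?t n k) \<le> norm (case p of (n, k) \<Rightarrow> ?u n k) * B"
      by simp
  qed simp
  then have summable: "(\<lambda>(n, k). ?t n k) summable_on (UNIV \<times> UNIV)"
    by (rule abs_summable_summable)
  have inner: "(\<Sum>\<^sub>\<infinity>k. ?t n k) = apply_ell1 (mult_ell1 \<sigma> a b) n x * \<xi> (iter_int \<sigma> (- n) x)" for n
    by (rule infsumI, rule has_sum_cmult_left)
      (use mult_ell1_apply_has_sum[OF homeo, of a x b n] in \<open>simp add: iter_int_alpha_apply[OF homeo]\<close>)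
  have outer: "(\<Sum>\<^sub>\<infinity>n. ?t n k) = apply_ell1 a k x * covariant_rep \<sigma> b \<xi> (iter_int \<sigma> (- k) x)" for k
  proof -
    have "(\<Sum>\<^sub>\<infinity>n. ?t n k) = (\<Sum>\<^sub>\<infinity>m. apply_ell1 a k x *
        (apply_ell1 b m (iter_int \<sigma> (- k) x) * \<xi> (iter_int \<sigma> (- m) (iter_int \<sigma> (- k) x))))"
      by (rule infsum_reindex_bij_witness[where i = "\<lambda>m. m + k" and j = "\<lambda>n. n - k"])
        (simp_all add: iter_int_alpha_apply[OF homeo] mult.assoc
          flip: iter_int_add[OF bij_of_homeomorphism[OF homeo]])
    then show ?thesis by (simp add: infsum_cmult_right' covariant_rep_def)
  qed
  show ?thesis
    using infsum_swap_banach[OF summable]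
    by (simp only: inner outer) (simp add: covariant_rep_def)
qed

lemma closed_rep_kernel: "closed (rep_kernel \<sigma>)"
proof -
  have "closed {a. covariant_rep \<sigma> a \<xi> x = 0}" if "bounded (range \<xi>)" for \<xi> x
  proof -
    obtain B where "\<And>y. norm (\<xi> y) \<le> B" using bounded_rangeE[OF \<open>bounded (range \<xi>)\<close>] by blast
    then show ?thesis
      by (intro closed_Collect_eq linear_continuous_on bounded_linear_covariant_rep continuous_on_const)
  qed
  moreover have "rep_kernel \<sigma> = (\<Inter>\<xi>\<in>{\<xi>. bounded (range \<xi>)}. \<Inter>x. {a. covariant_rep \<sigma> a \<xi> x = 0})"
    by (auto simp: rep_kernel_def)
  ultimately show ?thesis by (simp only:) (intro closed_INT ballI; simp)
qed

lemma ideal_rep_kernel: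
  fixes \<sigma> :: "'x::topological_space \<Rightarrow> 'x"
  assumes homeo: "homeomorphism UNIV UNIV \<sigma> (inv \<sigma>)"
  shows "ideal_ell1 \<sigma> (rep_kernel \<sigma>)"
proof -
  have "covariant_rep \<sigma> 0 \<xi> x = 0" for \<xi> x
    by (simp add: covariant_rep_def zero_ell1.rep_eq)
  moreover have "covariant_rep \<sigma> (a + b) \<xi> x = covariant_rep \<sigma> a \<xi> x + covariant_rep \<sigma> b \<xi> x"
    if "bounded (range \<xi>)" for a b \<xi> x
  proof -
    obtain B where "\<And>y. norm (\<xi> y) \<le> B" using bounded_rangeE[OF \<open>bounded (range \<xi>)\<close>] by blast
    from bounded_linear_covariant_rep[where \<xi> = \<xi>, OF this] show ?thesis
      by (rule linear_add[OF bounded_linear.linear])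
  qed
  moreover have "covariant_rep \<sigma> (scaleC_ell1 c a) \<xi> x = c * covariant_rep \<sigma> a \<xi> x" for c a \<xi> x
    by (simp add: covariant_rep_def scaleC_ell1.rep_eq mult.assoc infsum_cmult_right')
  moreover have "covariant_rep \<sigma> (mult_ell1 \<sigma> a b) \<xi> x = 0"
    if "a \<in> rep_kernel \<sigma> \<or> b \<in> rep_kernel \<sigma>" "bounded (range \<xi>)" for a b \<xi> x
  proof -
    obtain B where B: "\<And>y. norm (\<xi> y) \<le> B" using bounded_rangeE[OF \<open>bounded (range \<xi>)\<close>] by blast
    have "bounded (range (covariant_rep \<sigma> b \<xi>))"
      using covariant_rep_has_sum(2)[where \<xi> = \<xi>, OF B] by (auto simp: bounded_iff)
    moreover have "covariant_rep \<sigma> a (\<lambda>_. 0) x = 0" by (simp add: covariant_rep_def)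
    moreover have "covariant_rep \<sigma> b \<xi> = (\<lambda>_. 0)" if "b \<in> rep_kernel \<sigma>"
      using that \<open>bounded (range \<xi>)\<close> by (auto simp: rep_kernel_def)
    ultimately show ?thesis
      using that(1) by (auto simp: covariant_rep_mult[where \<xi> = \<xi>, OF homeo B] rep_kernel_def)
  qed
  ultimately show ?thesis
    by (auto simp: ideal_ell1_def rep_kernel_def)
qed

text \<open>
  On a finite space the matrix of \<open>a\<^sup>*\<close> is the conjugate transpose of the matrix of \<open>a\<close>: decomposing
  \<open>\<xi>\<close> into point masses expresses the value of \<open>a\<^sup>*\<close> at \<open>\<xi>\<close> through values of \<open>a\<close> at point masses.
\<close>

lemma self_adjoint_rep_kernel:
  fixes \<sigma> :: "'x::topological_space \<Rightarrow> 'x"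
  assumes homeo: "homeomorphism UNIV UNIV \<sigma> (inv \<sigma>)"
    and fin: "finite (UNIV :: 'x set)"
  shows "self_adjoint_ell1 \<sigma> (rep_kernel \<sigma>)"
  unfolding self_adjoint_ell1_def
proof
  fix a assume a: "a \<in> rep_kernel \<sigma>"
  have "covariant_rep \<sigma> (star_ell1 \<sigma> a) \<xi> x = 0" for \<xi> x
  proof -
    let ?\<delta> = "\<lambda>z. if z = x then 1 else 0 :: complex"
    let ?m = "\<lambda>y n. cnj (apply_ell1 a (- n) y * ?\<delta> (iter_int \<sigma> n y))"
    have "((\<lambda>n. \<xi> y * ?m y n) has_sum 0) UNIV" for y
    proof -
      have "bounded (range ?\<delta>)" by (rule finite_imp_bounded) (use fin in simp)
      then have "covariant_rep \<sigma> a ?\<delta> y = 0" using a by (auto simp: rep_kernel_def)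
      moreover have "((\<lambda>n. apply_ell1 a n y * ?\<delta> (iter_int \<sigma> (- n) y)) has_sum
          covariant_rep \<sigma> a ?\<delta> y) UNIV"
        by (rule covariant_rep_has_sum[where B = 1]) simp
      ultimately have "((\<lambda>n. apply_ell1 a n y * ?\<delta> (iter_int \<sigma> (- n) y)) has_sum 0) UNIV"
        by simp
      also have "?this \<longleftrightarrow> ((\<lambda>n. apply_ell1 a (- n) y * ?\<delta> (iter_int \<sigma> n y)) has_sum 0) UNIV"
        by (rule has_sum_reindex_bij_witness[where i = uminus and j = uminus]) auto
      finally have "((\<lambda>n. ?m y n) has_sum cnj 0) UNIV" by (simp only: has_sum_cnj_iff)
      then show ?thesis using has_sum_cmult_right[where c = "\<xi> y"] by fastforce
    qed
    then have "((\<lambda>n. \<Sum>y\<in>UNIV. \<xi> y * ?m y n) has_sum (\<Sum>y\<in>(UNIV :: 'x set). 0)) UNIV"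
      by (intro has_sum_finite_sum[OF fin])
    moreover have "(\<Sum>y\<in>UNIV. \<xi> y * ?m y n)
        = apply_ell1 (star_ell1 \<sigma> a) n x * \<xi> (iter_int \<sigma> (- n) x)" for n
    proof -
      have "(\<Sum>y\<in>UNIV. \<xi> y * ?m y n)
          = (\<Sum>y\<in>UNIV. if y = iter_int \<sigma> (- n) x then \<xi> y * cnj (apply_ell1 a (- n) y) else 0)"
        by (rule sum.cong) (auto simp: iter_int_eq_iff[OF bij_of_homeomorphism[OF homeo]])
      also have "\<dots> = \<xi> (iter_int \<sigma> (- n) x) * cnj (apply_ell1 a (- n) (iter_int \<sigma> (- n) x))"
        using fin by simp
      finally show ?thesis
        by (simp add: apply_star_ell1[OF homeo] iter_int_alpha_apply[OF homeo] mult.commute)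
    qed
    ultimately show ?thesis by (simp add: covariant_rep_def infsumI)
  qed
  then show "star_ell1 \<sigma> a \<in> rep_kernel \<sigma>" by (simp add: rep_kernel_def)
qed

text \<open>
  If \<open>X\<close> is finite, then \<open>\<sigma>\<^sup>p\<close> is the identity for some \<open>p > 0\<close>, and the canonical representation
  cannot tell \<open>u\<^sup>p\<close> from the unit.  Its kernel therefore contains \<open>u\<^sup>p - 1 \<noteq> 0\<close>, but it does not
  contain the unit.
\<close>

lemma no_self_adjoint_ideals_imp_infinite:
  fixes \<sigma> :: "'x::topological_space \<Rightarrow> 'x"
  assumes homeo: "homeomorphism UNIV UNIV \<sigma> (inv \<sigma>)"
    and simple: "\<And>I. ideal_ell1 \<sigma> I \<Longrightarrow> self_adjoint_ell1 \<sigma> I \<Longrightarrow> closed I \<Longrightarrow> I = {0} \<or> I = UNIV"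
  shows "infinite (UNIV :: 'x set)"
proof
  let ?one = "const_bcontfun 1 :: 'x \<Rightarrow>\<^sub>C complex"
  assume fin: "finite (UNIV :: 'x set)"
  obtain p where p: "p > 0" "\<And>x. iter_int \<sigma> p x = x"
    using finite_imp_uniform_period[OF fin bij_of_homeomorphism[OF homeo]] by blast
  have per: "iter_int \<sigma> (- p) x = x" for x
    using iter_int_cancel(1)[OF bij_of_homeomorphism[OF homeo], of p x] p(2) by simp
  have "covariant_rep \<sigma> (single_ell1 p ?one - single_ell1 0 ?one) \<xi> x = 0"
    if "bounded (range \<xi>)" for \<xi> x
  proof -
    obtain B where "\<And>y. norm (\<xi> y) \<le> B" using bounded_rangeE[OF \<open>bounded (range \<xi>)\<close>] by blast
    then have "linear (\<lambda>a. covariant_rep \<sigma> a \<xi> x)"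
      by (intro bounded_linear.linear bounded_linear_covariant_rep)
    from linear_diff[OF this] show ?thesis
      by (simp add: covariant_rep_single per)
  qed
  then have "single_ell1 p ?one - single_ell1 0 ?one \<in> rep_kernel \<sigma>"
    by (simp add: rep_kernel_def)
  moreover have "apply_ell1 (single_ell1 p ?one - single_ell1 0 ?one) p undefined \<noteq> 0"
    using p(1) by (simp add: apply_ell1_diff apply_single_ell1)
  then have "single_ell1 p ?one - single_ell1 0 ?one \<noteq> 0"
    by (auto simp: zero_ell1.rep_eq)
  ultimately have "rep_kernel \<sigma> = UNIV"
    using simple[OF ideal_rep_kernel[OF homeo] self_adjoint_rep_kernel[OF homeo fin]
        closed_rep_kernel] by blast
  then have "single_ell1 0 ?one \<in> rep_kernel \<sigma>" by simp
  then have "covariant_rep \<sigma> (single_ell1 0 ?one) (\<lambda>_. 1) undefined = 0"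
    by (simp add: rep_kernel_def)
  then show False by (simp add: covariant_rep_single)
qed

section \<open>The zeroth coefficient of an element of a closed ideal\<close>

text \<open>
  The squares, not the functions themselves, sum to one, because below each function multiplies an
  element both from the left and from the right and so enters the zeroth coefficient squared.
\<close>

lemma squared_partition_of_unity:
  fixes U :: "'x::t2_space \<Rightarrow> 'x set"
  assumes comp: "compact (UNIV :: 'x set)" and U: "\<And>x. open (U x)" "\<And>x. x \<in> U x"
  obtains S and f :: "'x \<Rightarrow> 'x \<Rightarrow> real"
  where "finite S" "\<And>s. continuous_on UNIV (f s)" "\<And>y. (\<Sum>s\<in>S. (f s y)\<^sup>2) = 1"
    "\<And>s y. f s y \<noteq> 0 \<Longrightarrow> y \<in> U s"
proof -
  have "\<exists>g. continuous_on UNIV g \<and> g s = (1::real) \<and> (\<forall>y. g y \<noteq> 0 \<longrightarrow> y \<in> U s)" for s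
    using bump_function[OF comp U(1)[of s] U(2)[of s]] by metis
  then obtain g :: "'x \<Rightarrow> 'x \<Rightarrow> real"
    where g: "\<And>s. continuous_on UNIV (g s)" "\<And>s. g s s = 1" "\<And>s y. g s y \<noteq> 0 \<Longrightarrow> y \<in> U s"
    by metis
  have "open {y. g s y \<noteq> 0}" for s
    by (rule open_Collect_neq[OF g(1) continuous_on_const])
  moreover have "UNIV \<subseteq> (\<Union>s. {y. g s y \<noteq> 0})"
  proof
    show "y \<in> (\<Union>s. {y. g s y \<noteq> 0})" for y using g(2)[of y] by (auto intro!: exI[of _ y])
  qed
  ultimately obtain S where S: "finite S" "UNIV \<subseteq> (\<Union>s\<in>S. {y. g s y \<noteq> 0})"
    using compactE_image[OF comp, of UNIV "\<lambda>s. {y. g s y \<noteq> 0}"] by metis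
  define h where "h y = (\<Sum>s\<in>S. (g s y)\<^sup>2)" for y
  have pos: "h y > 0" for y
  proof -
    obtain s where "s \<in> S" "g s y \<noteq> 0" using S(2) by blast
    then show ?thesis unfolding h_def by (intro sum_pos2[OF S(1)]) auto
  qed
  show ?thesis
  proof (rule that[of S "\<lambda>s y. g s y / sqrt (h y)"])
    show "continuous_on UNIV (\<lambda>y. g s y / sqrt (h y))" for s
      using pos unfolding h_def by (intro continuous_intros g(1)) (simp add: less_imp_neq[symmetric])
    show "(\<Sum>s\<in>S. (g s y / sqrt (h y))\<^sup>2) = 1" for y
      using pos[of y] by (simp add: power_divide flip: sum_divide_distrib h_def)
    show "y \<in> U s" if "g s y / sqrt (h y) \<noteq> 0" for s y
      using that g(3) by auto
  qed (rule S(1))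
qed

lemma disjoint_translates_neighbourhood:
  fixes \<sigma> :: "'x::t2_space \<Rightarrow> 'x"
  assumes homeo: "homeomorphism UNIV UNIV \<sigma> (inv \<sigma>)"
    and F: "finite F" "\<And>n. n \<in> F \<Longrightarrow> iter_int \<sigma> n x \<noteq> x"
  obtains U where "open U" "x \<in> U" "\<And>n y. n \<in> F \<Longrightarrow> y \<in> U \<Longrightarrow> iter_int \<sigma> n y \<notin> U"
proof -
  have "\<exists>A B. open A \<and> open B \<and> x \<in> A \<and> iter_int \<sigma> n x \<in> B \<and> A \<inter> B = {}" if "n \<in> F" for n
    using hausdorff[OF F(2)[OF that, symmetric]] by blast
  then obtain A B where AB: "\<And>n. n \<in> F \<Longrightarrow> open (A n)" "\<And>n. n \<in> F \<Longrightarrow> open (B n)"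
    "\<And>n. n \<in> F \<Longrightarrow> x \<in> A n" "\<And>n. n \<in> F \<Longrightarrow> iter_int \<sigma> n x \<in> B n"
    "\<And>n. n \<in> F \<Longrightarrow> A n \<inter> B n = {}"
    by metis
  show ?thesis
  proof (rule that[of "\<Inter>n\<in>F. A n \<inter> iter_int \<sigma> n -` B n"])
    show "open (\<Inter>n\<in>F. A n \<inter> iter_int \<sigma> n -` B n)"
      using F(1) AB(1,2) by (intro open_INT ballI open_Int open_vimage_iter_int[OF homeo]) auto
    show "x \<in> (\<Inter>n\<in>F. A n \<inter> iter_int \<sigma> n -` B n)"
      using AB(3,4) by auto
    show "iter_int \<sigma> n y \<notin> (\<Inter>n\<in>F. A n \<inter> iter_int \<sigma> n -` B n)"
      if "n \<in> F" "y \<in> (\<Inter>n\<in>F. A n \<inter> iter_int \<sigma> n -` B n)" for n y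
      using that AB(5)[of n] by auto
  qed
qed

text \<open>
  Given a finite set \<open>F\<close> of exponents, freeness allows a partition \<open>\<Sum>s. f\<^sub>s\<^sup>2 = 1\<close> with each
  \<open>f\<^sub>s\<close> supported in a set that is disjoint from its translates by the nonzero elements of \<open>F\<close>.
  The element \<open>c = \<Sum>s. f\<^sub>s a f\<^sub>s\<close> lies in the ideal, and its \<open>n\<close>-th coefficient is \<open>a(n)\<close> times
  the weight \<open>w\<^sub>n = \<Sum>s. f\<^sub>s \<alpha>\<^sup>n(f\<^sub>s)\<close>.  The weight is 1 for \<open>n = 0\<close>, it vanishes for the other \<open>n\<close> in
  \<open>F\<close>, and it is at most 1 in absolute value for all \<open>n\<close>, however many functions the partition
  has.  So \<open>c\<close> differs from \<open>a(0)\<close> by at most the sum of \<open>\<parallel>a(n)\<parallel>\<close> over \<open>n\<close> outside \<open>F\<close>, which is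
  arbitrarily small.
\<close>

lemma zeroth_coefficient_in_closed_ideal:
  fixes \<sigma> :: "'x::t2_space \<Rightarrow> 'x"
  assumes comp: "compact (UNIV :: 'x set)"
    and homeo: "homeomorphism UNIV UNIV \<sigma> (inv \<sigma>)"
    and free: "\<And>n x. n \<noteq> 0 \<Longrightarrow> iter_int \<sigma> n x \<noteq> x"
    and I: "ideal_ell1 \<sigma> I" "closed I" and a: "a \<in> I"
  shows "single_ell1 0 (apply_ell1 a 0) \<in> I"
proof -
  have "\<exists>c\<in>I. dist c (single_ell1 0 (apply_ell1 a 0)) < e" if "e > 0" for e
  proof -
    obtain F where F: "finite F" "dist (\<Sum>n\<in>F. norm (apply_ell1 a n)) (norm a) \<le> e / 2"
      using infsum_finite_approximation[OF norm_summable_ell1[of a], of "e / 2"] \<open>e > 0\<close>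
      unfolding norm_ell1_def by auto
    \<comment> \<open>The exponents are negated because \<open>\<alpha>\<^sup>n\<close> composes a function with \<open>\<sigma>\<^sup>-\<^sup>n\<close>.\<close>
    have "\<exists>U. open U \<and> x \<in> U \<and> (\<forall>n\<in>uminus ` F - {0}. \<forall>y\<in>U. iter_int \<sigma> n y \<notin> U)" for x
    proof -
      have "finite (uminus ` F - {0})" using F(1) by simp
      moreover have "iter_int \<sigma> n x \<noteq> x" if "n \<in> uminus ` F - {0}" for n
        using that free by simp
      ultimately show ?thesis
        using disjoint_translates_neighbourhood[OF homeo] by metis
    qed
    then obtain U where U: "\<And>x. open (U x)" "\<And>x. x \<in> U x"
      "\<And>x n y. n \<in> uminus ` F - {0} \<Longrightarrow> y \<in> U x \<Longrightarrow> iter_int \<sigma> n y \<notin> U x"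
      by metis
    obtain S and f :: "'x \<Rightarrow> 'x \<Rightarrow> real" where f: "finite S" "\<And>s. continuous_on UNIV (f s)"
      "\<And>y. (\<Sum>s\<in>S. (f s y)\<^sup>2) = 1" "\<And>s y. f s y \<noteq> 0 \<Longrightarrow> y \<in> U s"
      using squared_partition_of_unity[OF comp U(1,2)] by blast
    define g where "g s = Bcontfun (\<lambda>y. complex_of_real (f s y))" for s
    have g: "apply_bcontfun (g s) y = f s y" for s y
      unfolding g_def by (rule apply_Bcontfun_of_real[OF comp f(2)])
    define c where "c = (\<Sum>s\<in>S. mult_ell1 \<sigma> (single_ell1 0 (g s)) (mult_ell1 \<sigma> a (single_ell1 0 (g s))))"
    have "c \<in> I"
      unfolding c_def using a I(1) by (intro ideal_ell1_sum[OF I(1)]) (simp add: ideal_ell1_def)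
    define w where "w n y = (\<Sum>s\<in>S. f s y * f s (iter_int \<sigma> (- n) y))" for n y
    have c: "apply_ell1 c n y = apply_ell1 a n y * w n y" for n y
      by (simp add: c_def w_def apply_ell1_sum apply_bcontfun_sum mult_single_left_apply[OF homeo]
          mult_single_right_apply[OF homeo] g sum_distrib_left mult.left_commute)
    have w_0: "w 0 y = 1" for y
      using f(3)[of y] by (simp add: w_def power2_eq_square)
    have w_F: "w n y = 0" if "n \<in> F" "n \<noteq> 0" for n y
      unfolding w_def
    proof (rule sum.neutral, rule ballI)
      fix s
      show "f s y * f s (iter_int \<sigma> (- n) y) = 0"
        using f(4)[of s y] f(4)[of s "iter_int \<sigma> (- n) y"] U(3)[of "- n" y s] that by auto
    qed
    have w_le: "\<bar>w n y\<bar> \<le> 1" for n y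
    proof -
      have "\<bar>u * v\<bar> \<le> (u\<^sup>2 + v\<^sup>2) / 2" for u v :: real
        using sum_squares_bound[of u v] sum_squares_bound[of u "- v"] by (simp add: abs_le_iff)
      then have "\<bar>w n y\<bar> \<le> (\<Sum>s\<in>S. ((f s y)\<^sup>2 + (f s (iter_int \<sigma> (- n) y))\<^sup>2) / 2)"
        unfolding w_def by (intro order_trans[OF sum_abs] sum_mono)
      also have "\<dots> = 1"
        by (simp add: f(3) sum.distrib flip: sum_divide_distrib)
      finally show ?thesis .
    qed
    \<comment> \<open>As a difference, the sum of the tail over all \<open>n\<close> is the norm of \<open>a\<close> minus a finite sum.\<close>
    let ?tail = "\<lambda>n. norm (apply_ell1 a n) - (if n \<in> F then norm (apply_ell1 a n) else 0)"
    have le: "norm (apply_ell1 (c - single_ell1 0 (apply_ell1 a 0)) n) \<le> ?tail n" for n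
    proof (cases "n = 0")
      case True
      then have "apply_ell1 (c - single_ell1 0 (apply_ell1 a 0)) n = 0"
        by (intro bcontfun_eqI) (simp add: apply_ell1_diff apply_single_ell1 c w_0)
      then show ?thesis by simp
    next
      case False
      show ?thesis
      proof (rule norm_bound)
        fix y
        have "norm (apply_ell1 a n y) * \<bar>w n y\<bar> \<le> norm (apply_ell1 a n) * 1"
          by (intro mult_mono norm_bounded w_le) simp_all
        then show "norm (apply_ell1 (c - single_ell1 0 (apply_ell1 a 0)) n y) \<le> ?tail n"
          using False w_F[of n y] by (auto simp: apply_ell1_diff apply_single_ell1 c norm_mult)
      qed
    qed
    have "((\<lambda>n. if n \<in> F then norm (apply_ell1 a n) else 0) has_sum
        (\<Sum>n\<in>F. norm (apply_ell1 a n))) UNIV"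
      by (rule has_sum_finite_neutralI[OF F(1)]) auto
    from has_sum_add[OF has_sum_infsum[OF norm_summable_ell1[of a]] has_sum_uminusI[OF this]]
    have "(?tail has_sum norm a - (\<Sum>n\<in>F. norm (apply_ell1 a n))) UNIV"
      by (simp add: norm_ell1_def)
    then have "norm (c - single_ell1 0 (apply_ell1 a 0)) \<le> norm a - (\<Sum>n\<in>F. norm (apply_ell1 a n))"
      using has_sum_mono[OF has_sum_infsum[OF norm_summable_ell1] _ le] by (simp add: norm_ell1_def)
    also have "\<dots> < e"
      using F(2) \<open>e > 0\<close> unfolding dist_real_def by linarith
    finally show ?thesis using \<open>c \<in> I\<close> by (auto simp: dist_norm)
  qed
  then have "single_ell1 0 (apply_ell1 a 0) \<in> closure I"
    by (simp add: closure_approachable)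
  then show ?thesis using I(2) by simp
qed


section \<open>Simplicity of free minimal systems\<close>

text \<open>
  By minimality every orbit meets the open set where \<open>f \<noteq> 0\<close>, and by compactness finitely many
  translates of that set cover \<open>X\<close>.  So a finite sum of translates of \<open>\<bar>f\<bar>\<^sup>2\<close>, which the ideal
  contains, is strictly positive and thus invertible in \<open>C(X)\<close>.
\<close>

lemma ideal_containing_function_eq_UNIV:
  fixes \<sigma> :: "'x::t2_space \<Rightarrow> 'x"
  assumes comp: "compact (UNIV :: 'x set)"
    and homeo: "homeomorphism UNIV UNIV \<sigma> (inv \<sigma>)"
    and minimal: "minimal_system \<sigma>"
    and I: "ideal_ell1 \<sigma> I" and f: "single_ell1 0 f \<in> I" "f \<noteq> 0"
  shows "I = UNIV"
proof -
  let ?U = "{y. apply_bcontfun f y \<noteq> 0}"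
  have open_U: "open ?U" by (intro open_Collect_neq) simp_all
  have nonempty: "?U \<noteq> {}" using f(2) by (auto intro: bcontfun_eqI)
  have visits: "\<exists>k. iter_int \<sigma> k x \<in> ?U" for x
  proof -
    have "?U \<inter> closure (range (\<lambda>n. iter_int \<sigma> n x)) \<noteq> {}"
      using minimal nonempty by (simp add: minimal_system_def)
    then show ?thesis using open_Int_closure_eq_empty[OF open_U] by blast
  qed
  obtain K where K: "finite K" "UNIV \<subseteq> (\<Union>k\<in>K. iter_int \<sigma> k -` ?U)"
  proof (rule compactE_image[OF comp, of UNIV "\<lambda>k. iter_int \<sigma> k -` ?U"])
    show "open (iter_int \<sigma> k -` ?U)" for k by (rule open_vimage_iter_int[OF homeo open_U])
    show "UNIV \<subseteq> (\<Union>k. iter_int \<sigma> k -` ?U)" using visits by blast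
  qed (use that in blast)
  define h where "h x = (\<Sum>k\<in>K. (cmod (f (iter_int \<sigma> k x)))\<^sup>2)" for x
  have pos: "h x > 0" for x
  proof -
    obtain k where "k \<in> K" "f (iter_int \<sigma> k x) \<noteq> 0" using K(2) by blast
    then show ?thesis unfolding h_def by (intro sum_pos2[OF K(1)]) auto
  qed
  have cont: "continuous_on UNIV h"
    unfolding h_def
    by (intro continuous_intros continuous_on_compose2[OF continuous_on_apply_bcontfun[of UNIV f]
          continuous_iter_int[OF homeo]]) auto
  define H where "H = Bcontfun (\<lambda>x. complex_of_real (h x))"
  define J where "J = Bcontfun (\<lambda>x. complex_of_real (1 / h x))"
  have H: "apply_bcontfun H x = h x" for x
    unfolding H_def by (rule apply_Bcontfun_of_real[OF comp cont])
  have "continuous_on UNIV (\<lambda>x. 1 / h x)"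
    using pos by (intro continuous_intros cont) (simp add: less_imp_neq[symmetric])
  then have J: "apply_bcontfun J x = complex_of_real (1 / h x)" for x
    unfolding J_def by (rule apply_Bcontfun_of_real[OF comp])
  let ?one = "const_bcontfun 1 :: 'x \<Rightarrow>\<^sub>C complex"
  \<comment> \<open>\<open>u\<^sup>-\<^sup>k \<bar>f\<bar>\<^sup>2 u\<^sup>k\<close>, the translate \<open>\<bar>f\<bar>\<^sup>2 \<circ> \<sigma>\<^sup>k\<close>\<close>
  define b where "b k = mult_ell1 \<sigma> (single_ell1 (- k) ?one) (mult_ell1 \<sigma> (single_ell1 0 (cnj_bcontfun f))
      (mult_ell1 \<sigma> (single_ell1 0 f) (single_ell1 k ?one)))" for k
  have "b k \<in> I" for k
    using I f(1) by (simp add: b_def ideal_ell1_def)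
  then have "(\<Sum>k\<in>K. b k) \<in> I" by (intro ideal_ell1_sum[OF I])
  moreover have "apply_ell1 (b k) n x = (if n = 0 then (cmod (f (iter_int \<sigma> k x)))\<^sup>2 else 0)" for k n x
    by (auto simp: b_def mult_single_left_apply[OF homeo] mult_single_right_apply[OF homeo]
        apply_single_ell1 complex_norm_square[symmetric] mult.commute)
  then have "(\<Sum>k\<in>K. b k) = single_ell1 0 H"
    by (intro ell1_eqI bcontfun_eqI)
      (simp add: apply_ell1_sum apply_bcontfun_sum apply_single_ell1 H h_def)
  ultimately have "single_ell1 0 H \<in> I" by simp
  then have "mult_ell1 \<sigma> (single_ell1 0 H) (mult_ell1 \<sigma> (single_ell1 0 J) d) \<in> I" for d
    using I by (simp add: ideal_ell1_def)
  moreover have "mult_ell1 \<sigma> (single_ell1 0 H) (mult_ell1 \<sigma> (single_ell1 0 J) d) = d" for d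
    using pos by (intro ell1_eqI bcontfun_eqI)
      (simp add: mult_single_left_apply[OF homeo] H J less_imp_neq[symmetric])
  ultimately show ?thesis by (metis UNIV_eq_I)
qed

lemma infinite_minimal_imp_simple:
  fixes \<sigma> :: "'x::t2_space \<Rightarrow> 'x"
  assumes comp: "compact (UNIV :: 'x set)"
    and homeo: "homeomorphism UNIV UNIV \<sigma> (inv \<sigma>)"
    and inf: "infinite (UNIV :: 'x set)" and minimal: "minimal_system \<sigma>"
    and I: "ideal_ell1 \<sigma> I" "closed I"
  shows "I = {0} \<or> I = UNIV"
proof (rule disjCI)
  assume "I \<noteq> UNIV"
  have "a = 0" if "a \<in> I" for a
  proof (rule ccontr)
    assume "a \<noteq> 0"
    then obtain k where k: "apply_ell1 a k \<noteq> 0"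
      using ell1_eqI[of a 0] by (auto simp: zero_ell1.rep_eq)
    \<comment> \<open>Multiplying by \<open>u\<^sup>-\<^sup>k\<close> moves the nonzero coefficient to position 0.\<close>
    let ?b = "mult_ell1 \<sigma> a (single_ell1 (- k) (const_bcontfun 1))"
    have "apply_ell1 ?b 0 = apply_ell1 a k"
      by (rule bcontfun_eqI) (simp add: mult_single_right_apply[OF homeo])
    moreover have "?b \<in> I" using \<open>a \<in> I\<close> I(1) by (simp add: ideal_ell1_def)
    then have "single_ell1 0 (apply_ell1 ?b 0) \<in> I"
      by (intro zeroth_coefficient_in_closed_ideal[OF comp homeo _ I]
          infinite_minimal_imp_free[OF bij_of_homeomorphism[OF homeo] inf minimal])
    ultimately show False
      using ideal_containing_function_eq_UNIV[OF comp homeo minimal I(1)] k \<open>I \<noteq> UNIV\<close> by metis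
  qed
  then show "I = {0}" using I(1) by (auto simp: ideal_ell1_def)
qed

theorem theorem4p2:
  fixes \<sigma> :: "'x::t2_space \<Rightarrow> 'x"
  assumes "compact (UNIV :: 'x set)"
    and "homeomorphism UNIV UNIV \<sigma> (inv \<sigma>)"
  shows "((\<forall>I. ideal_ell1 \<sigma> I \<and> closed I \<longrightarrow> I = {0} \<or> I = UNIV) \<longleftrightarrow>
          (\<forall>I. ideal_ell1 \<sigma> I \<and> self_adjoint_ell1 \<sigma> I \<and> closed I \<longrightarrow> I = {0} \<or> I = UNIV))
       \<and> ((\<forall>I. ideal_ell1 \<sigma> I \<and> self_adjoint_ell1 \<sigma> I \<and> closed I \<longrightarrow> I = {0} \<or> I = UNIV) \<longleftrightarrow>
          infinite (UNIV :: 'x set) \<and> minimal_system \<sigma>)"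
proof -
  let ?simple = "\<forall>I. ideal_ell1 \<sigma> I \<and> closed I \<longrightarrow> I = {0} \<or> I = UNIV"
  let ?star_simple =
    "\<forall>I. ideal_ell1 \<sigma> I \<and> self_adjoint_ell1 \<sigma> I \<and> closed I \<longrightarrow> I = {0} \<or> I = UNIV"
  have "?simple \<Longrightarrow> ?star_simple" by blast
  moreover have "infinite (UNIV :: 'x set) \<and> minimal_system \<sigma>" if ?star_simple
  proof
    show "infinite (UNIV :: 'x set)"
      by (rule no_self_adjoint_ideals_imp_infinite[OF assms(2)]) (use that in blast)
    show "minimal_system \<sigma>"
      by (rule no_self_adjoint_ideals_imp_minimal[OF assms]) (use that in blast)
  qed
  moreover have "?simple" if "infinite (UNIV :: 'x set) \<and> minimal_system \<sigma>"
    using infinite_minimal_imp_simple[OF assms] that by blast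
  ultimately show ?thesis by argo
qed

end
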